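(* Let $\mathcal{S}=\{\pm1\pm i\}$ be the 4-PSK constellation, and let $\gamma e^{j\theta}$ be a singular fade state for two-way ACF relaying with signal set $\mathcal{S}$ at both end nodes. Let $\mathcal{C}^{[\gamma e^{j\theta}]}$ be a clustering of $\mathcal{S}^2$ for two-way 2-stage relaying which removes the singular fade state $\gamma e^{j\theta}$. Then the clustering of $\mathcal{S}^4$ given by the Cartesian Product $\mathcal{D}^{[\gamma e^{j\theta}]}$ of $\mathcal{C}^{[\gamma e^{j\theta}]}$ with itself removes the singular fade state $\gamma e^{j\theta}$ for two-way ACF relaying.
   Context: A fade state is a complex number $z=\gamma e^{j\theta}$ with $\gamma>0$, $j=\sqrt{-1}$. 2-stage relaying: A and B transmit $x_A,x_B\in\mathcal{S}$ and the relay sees $x_A+zx_B$. A clustering for 2-stage relaying is a partition of $\mathcal{S}^2$ (elements written $(x_A,x_B)$) satisfying the exclusive law: distinct elements sharing the same $x_A$, or sharing the same $x_B$, lie in different clusters. It removes the singular fade state $z$ if any two elements $(x_A,x_B),(x'_A,x'_B)\in\mathcal{S}^2$ with $x_A+zx_B=x'_A+zx'_B$ lie in the same cluster. ACF relaying: A and B transmit $x_{A_1},x_{B_1}$ in a first and $x_{A_2},x_{B_2}$ in a second channel use, all in $\mathcal{S}$, with the same $z$. A fade state $z$ is singular for ACF relaying if the set $\{(x_{A_1}+zx_{B_1},x_{A_2}+zx_{B_2}) : x_{A_1},x_{B_1},x_{A_2},x_{B_2}\in\mathcal{S}\}$ has fewer than $4^4$ elements. A clustering of $\mathcal{S}^4$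 (elements written $((x_{A_1},x_{B_1}),(x_{A_2},x_{B_2}))$) removes the singular fade state $z$ if any two elements $((x_{A_1},x_{B_1}),(x_{A_2},x_{B_2}))$ and $((x'_{A_1},x'_{B_1}),(x'_{A_2},x'_{B_2}))$ with $x_{A_1}+zx_{B_1}=x'_{A_1}+zx'_{B_1}$ and $x_{A_2}+zx_{B_2}=x'_{A_2}+zx'_{B_2}$ lie in the same cluster (equivalently, the minimum distance between effective points belonging to different clusters is positive). Cartesian Product: if $\mathcal{C}=\{l_1,\dots,l_m\}$ is a clustering of $\mathcal{S}^2$, its Cartesian Product with itself is the collection $\mathcal{D}=\{\mathcal{C}^{\{l_i,l_j\}} : 1\le i,j\le m\}$ of subsets of $\mathcal{S}^4$, where $\mathcal{C}^{\{l_i,l_j\}}=\{((x,y),(x',y')) : (x,y)\in l_i,\ (x',y')\in l_j\}$. *)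

theory Defs
  imports Complex_Main "HOL-Library.Disjoint_Sets"
begin

definition psk4 :: "complex set" where
  "psk4 = {1 + \<i>, 1 - \<i>, - 1 + \<i>, - 1 - \<i>}"

text \<open>Point seen by the relay in one channel use, for the pair \<open>(x\<^sub>A, x\<^sub>B)\<close> and fade state \<open>z\<close>.\<close>

definition relay_point :: "complex \<Rightarrow> complex \<times> complex \<Rightarrow> complex" where
  "relay_point z p = fst p + z * snd p"

definition exclusive_law :: "(complex \<times> complex) set set \<Rightarrow> bool" where
  "exclusive_law C \<longleftrightarrow>
    (\<forall>p \<in> psk4 \<times> psk4. \<forall>q \<in> psk4 \<times> psk4.
      p \<noteq> q \<and> (fst p = fst q \<or> snd p = snd q) \<longrightarrow> \<not> (\<exists>l \<in> C. p \<in> l \<and> q \<in> l))"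

definition clustering_2stage :: "(complex \<times> complex) set set \<Rightarrow> bool" where
  "clustering_2stage C \<longleftrightarrow> partition_on (psk4 \<times> psk4) C \<and> exclusive_law C"

definition removes_2stage :: "complex \<Rightarrow> (complex \<times> complex) set set \<Rightarrow> bool" where
  "removes_2stage z C \<longleftrightarrow>
    (\<forall>p \<in> psk4 \<times> psk4. \<forall>q \<in> psk4 \<times> psk4.
      relay_point z p = relay_point z q \<longrightarrow> (\<exists>l \<in> C. p \<in> l \<and> q \<in> l))"

text \<open>
  In ACF relaying an element of the fourth power of the signal set is a pair of pairs
  \<open>((x\<^sub>A\<^sub>1, x\<^sub>B\<^sub>1), (x\<^sub>A\<^sub>2, x\<^sub>B\<^sub>2))\<close>, grouped by channel use rather than by end node.
\<close>

type_synonym acf_element = "(complex \<times> complex) \<times> (complex \<times> complex)"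

definition psk4_acf :: "acf_element set" where
  "psk4_acf = (psk4 \<times> psk4) \<times> (psk4 \<times> psk4)"

definition acf_point :: "complex \<Rightarrow> acf_element \<Rightarrow> complex \<times> complex" where
  "acf_point z u = (relay_point z (fst u), relay_point z (snd u))"

definition singular_acf :: "complex \<Rightarrow> bool" where
  "singular_acf z \<longleftrightarrow> card (acf_point z ` psk4_acf) < 4 ^ 4"

definition clustering_acf :: "acf_element set set \<Rightarrow> bool" where
  "clustering_acf D \<longleftrightarrow> partition_on psk4_acf D"

definition removes_acf :: "complex \<Rightarrow> acf_element set set \<Rightarrow> bool" where
  "removes_acf z D \<longleftrightarrow>
    (\<forall>u \<in> psk4_acf. \<forall>v \<in> psk4_acf.
      acf_point z u = acf_point z v \<longrightarrow> (\<exists>d \<in> D. u \<in> d \<and> v \<in> d))"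

definition cartesian_clustering :: "(complex \<times> complex) set set \<Rightarrow> acf_element set set" where
  "cartesian_clustering C = {l \<times> l' | l l'. l \<in> C \<and> l' \<in> C}"

end

theory Submission
  imports Defs
begin

text \<open>The ACF point is the pair of relay points of the two channel uses, so a collision in ACF
  relaying is a collision in each use separately. If \<open>C\<close> merges all 2-stage collisions,
  one block \<open>l\<close> holds both first components and one block \<open>l'\<close> both second
  components, so \<open>l \<times> l'\<close> holds both elements
  (\<open>removes_acf_cartesian_clustering\<close>). That these products form a clustering is the
  general fact \<open>partition_on_Times\<close>.\<close>

lemma partition_on_Times:
  assumes "partition_on A P" and "partition_on B Q"
  shows "partition_on (A \<times> B) {l \<times> l' | l l'. l \<in> P \<and> l' \<in> Q}"
proof (rule partition_onI)
  show "\<Union>{l \<times> l' | l l'. l \<in> P \<and> l' \<in> Q} = A \<times> B"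
    using partition_onD1[OF assms(1)] partition_onD1[OF assms(2)] by blast
next
  fix d e
  assume "d \<in> {l \<times> l' | l l'. l \<in> P \<and> l' \<in> Q}"
    and "e \<in> {l \<times> l' | l l'. l \<in> P \<and> l' \<in> Q}" and "d \<noteq> e"
  then obtain l l' m m' where d: "d = l \<times> l'" "l \<in> P" "l' \<in> Q"
    and e: "e = m \<times> m'" "m \<in> P" "m' \<in> Q" and "l \<noteq> m \<or> l' \<noteq> m'"
    by blast
  \<comment> \<open>Disjointness in a single factor already separates the products, so it suffices
    to use whichever factor differs.\<close>
  then have "l \<inter> m = {} \<or> l' \<inter> m' = {}"
    using partition_onD2[OF assms(1)] partition_onD2[OF assms(2)]
    by (meson disjointD)
  then show "disjnt d e"
    unfolding d e disjnt_def by blast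
next
  show "{} \<notin> {l \<times> l' | l l'. l \<in> P \<and> l' \<in> Q}"
    \<comment> \<open>A product is empty only if a factor is; \<open>sym\<close> turns
      \<open>{} = l \<times> l'\<close> into the orientation that \<open>Times_empty\<close>
      rewrites.\<close>
    using partition_onD3[OF assms(1)] partition_onD3[OF assms(2)] by (auto simp: Times_empty dest!: sym[of "{}"])
qed

lemma removes_acf_cartesian_clustering:
  assumes "removes_2stage z C"
  shows "removes_acf z (cartesian_clustering C)"
  unfolding removes_acf_def
proof (intro ballI impI)
  fix u v
  assume "u \<in> psk4_acf" "v \<in> psk4_acf" "acf_point z u = acf_point z v"
  \<comment> \<open>Injectivity of pairing splits the equation of ACF points into one per channel
    use; the hypothesis on \<open>C\<close> is applied to each, and the two blocks may
    differ.\<close>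
  then obtain l l' where "l \<in> C" "fst u \<in> l" "fst v \<in> l" "l' \<in> C" "snd u \<in> l'" "snd v \<in> l'"
    using assms unfolding removes_2stage_def psk4_acf_def acf_point_def mem_Times_iff[of _ "psk4 \<times> psk4"]
    by (metis prod.inject)
  then show "\<exists>d \<in> cartesian_clustering C. u \<in> d \<and> v \<in> d"
    unfolding cartesian_clustering_def by (intro bexI[of _ "l \<times> l'"]) (auto simp: mem_Times_iff)
qed

theorem lemma2:
  fixes \<gamma> \<theta> :: real
    and C :: "(complex \<times> complex) set set"
  assumes "\<gamma> > 0"
    and "singular_acf (rcis \<gamma> \<theta>)"
    and "clustering_2stage C"
    and "removes_2stage (rcis \<gamma> \<theta>) C"
  shows "clustering_acf (cartesian_clustering C) \<and>
         removes_acf (rcis \<gamma> \<theta>) (cartesian_clustering C)"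
  using assms(3,4) partition_on_Times removes_acf_cartesian_clustering
  unfolding clustering_acf_def clustering_2stage_def cartesian_clustering_def psk4_acf_def
  by blast

end
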